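(* Let $\mathcal{C}\subseteq\mathbb{R}^n$ be a nonempty polytope, let $f\colon\mathcal{C}\to\mathbb{R}$ be convex and differentiable in an open set containing $\mathcal{C}$, and suppose that $(\mathcal{C},f)$ has $L$-curvature for some $L>0$ and satisfies the $(\mu,\theta)$-error bound relative to the radial distance $\mathfrak{r}$ for some $\mu>0$ and $\theta\in[0,1/2]$. Then the iterates $\mathbf{x}^{(t)}$, $t\in\mathbb{N}$, of the Frank-Wolfe algorithm with line-search or short-step satisfy the following convergence rates. (i) When $\theta=1/2$, for all $t\in\mathbb{N}$: $$f(\mathbf{x}^{(t)})-f^*\le (f(\mathbf{x}^{(0)})-f^* )\left(1-\min\left\{\frac{\mu}{2L},\frac12\right\}\right)^{t}.$$ (ii) When $\theta\in[0,1/2)$, for all $t\in\{0,1,\dots,t_0\}$: $$f(\mathbf{x}^{(t)})-f^*\le\frac{f(\mathbf{x}^{(0)})-f^*}{2^t},$$ where $t_0\in\mathbb{N}$ is the smallest $t$ such that $$\frac{\mu^{2\theta}(f(\mathbf{x}^{(t)})-f^* )^{1-2\theta}}{2L}\le\frac12 .$$ Then for all $t\in\mathbb{N}$ with $t>t_0$: $$f(\mathbf{x}^{(t)})-f^*\le\left((f(\mathbf{x}^{(t_0)})-f^* )^{2\theta-1}+\frac{(1-2\theta)\mu^{2\theta}(t-t_0)}{2L}\right)^{\frac{1}{2\theta-1}}.$$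
   Context: $\mathbb{N}=\{0,1,2,\dots\}$. $f^*=\min_{\mathbf{x}\in\mathcal{C}}f(\mathbf{x})$ and $X^*=\{\mathbf{x}\in\mathcal{C}\mid f(\mathbf{x})=f^*\}$. $L$-curvature: $(\mathcal{C},f)$ has $L$-curvature if for all $\mathbf{x}\in\mathcal{C}$, $\mathbf{d}\in\mathcal{C}-\mathbf{x}$ and $\eta\in[0,1]$, $f(\mathbf{x}+\eta\mathbf{d})\le f(\mathbf{x})+\eta\langle\nabla f(\mathbf{x}),\mathbf{d}\rangle+\frac{L\eta^2}{2}$. Radial distance: $\mathfrak{r}\colon\mathcal{C}\times\mathcal{C}\to[0,1]$, $\mathfrak{r}(\mathbf{y},\mathbf{x})=\min\{\rho\ge0\mid\mathbf{y}-\mathbf{x}=\rho(\mathbf{v}-\mathbf{x})\text{ for some }\mathbf{v}\in\mathcal{C}\}$. Error bound: for $\mathfrak{d}\colon\mathcal{C}\times\mathcal{C}\to[0,1]$, $\mu>0$, $\theta\in[0,1/2]$, $(\mathcal{C},f)$ satisfies the $(\mu,\theta)$-error bound relative to $\mathfrak{d}$ if for all $\mathbf{x}\in\mathcal{C}$, $\left(\frac{f(\mathbf{x})-f^*}{\mu}\right)^\theta\ge\min_{\mathbf{x}^*\in X^*}\mathfrak{d}(\mathbf{x}^*,\mathbf{x})$. Frank-Wolfe algorithm: starting from any $\mathbf{x}^{(0)}\in\mathcal{C}$, for each $t\in\mathbb{N}$ choose $\mathbf{v}^{(t)}\in\arg\min_{\mathbf{v}\in\mathcal{C}}\langle\nabla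 f(\mathbf{x}^{(t)}),\mathbf{v}\rangle$ (a vertex of $\mathcal{C}$) and set $\mathbf{x}^{(t+1)}=\mathbf{x}^{(t)}+\eta_t(\mathbf{v}^{(t)}-\mathbf{x}^{(t)})$ with $\eta_t\in[0,1]$. Line-search: $\eta_t\in\arg\min_{\eta\in[0,1]}f(\mathbf{x}^{(t)}+\eta(\mathbf{v}^{(t)}-\mathbf{x}^{(t)}))$. Short-step: $\eta_t=\arg\min_{\eta\in[0,1]}\{f(\mathbf{x}^{(t)})+\eta\langle\nabla f(\mathbf{x}^{(t)}),\mathbf{v}^{(t)}-\mathbf{x}^{(t)}\rangle+\frac{L\eta^2}{2}\}$, where $L$ is the curvature constant. *)

theory Defs
  imports "HOL-Analysis.Analysis"
begin

definition grad :: "('a::real_inner \<Rightarrow> real) \<Rightarrow> 'a \<Rightarrow> 'a" where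
  "grad f x = (THE D. GDERIV f x :> D)"

text \<open>
  Minima of real-valued quantities are written as infima. For compact \<open>C\<close> and
  continuous \<open>f\<close> all of them are attained: see \<open>opt_value_attained\<close>,
  \<open>radial_dist_attained\<close> and \<open>radial_dist_opt_set_attained\<close> below.
\<close>

definition opt_value :: "'a set \<Rightarrow> ('a \<Rightarrow> real) \<Rightarrow> real" where
  "opt_value C f = (INF x\<in>C. f x)"

definition opt_set :: "'a set \<Rightarrow> ('a \<Rightarrow> real) \<Rightarrow> 'a set" where
  "opt_set C f = {x \<in> C. f x = opt_value C f}"

definition has_curvature :: "'a::real_inner set \<Rightarrow> ('a \<Rightarrow> real) \<Rightarrow> real \<Rightarrow> bool" where
  "has_curvature C f L \<longleftrightarrow>
     (\<forall>x\<in>C. \<forall>d\<in>(\<lambda>y. y - x) ` C. \<forall>\<eta>\<in>{0..1}.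
        f (x + \<eta> *\<^sub>R d) \<le> f x + \<eta> * (grad f x \<bullet> d) + L * \<eta>\<^sup>2 / 2)"

definition radial_dist :: "'a::real_vector set \<Rightarrow> 'a \<Rightarrow> 'a \<Rightarrow> real" where
  "radial_dist C y x = Inf {\<rho>. \<rho> \<ge> 0 \<and> (\<exists>v\<in>C. y - x = \<rho> *\<^sub>R (v - x))}"

text \<open>
  The case distinction in the error bound implements the convention \<open>0\<^sup>0 = 1\<close>
  (whereas \<open>0 powr 0 = 0\<close>): for \<open>\<theta> = 0\<close> the bound holds for every
  \<open>[0,1]\<close>-valued distance.
\<close>

definition error_bound ::
    "'a set \<Rightarrow> ('a \<Rightarrow> real) \<Rightarrow> ('a \<Rightarrow> 'a \<Rightarrow> real) \<Rightarrow> real \<Rightarrow> real \<Rightarrow> bool" where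
  "error_bound C f \<dd> \<mu> \<theta> \<longleftrightarrow>
     (\<forall>x\<in>C. (if \<theta> = 0 then 1 else ((f x - opt_value C f) / \<mu>) powr \<theta>)
             \<ge> (INF y\<in>opt_set C f. \<dd> y x))"

definition frank_wolfe ::
    "'a::real_inner set \<Rightarrow> ('a \<Rightarrow> real) \<Rightarrow> (nat \<Rightarrow> 'a) \<Rightarrow> (nat \<Rightarrow> 'a) \<Rightarrow> (nat \<Rightarrow> real) \<Rightarrow> bool" where
  "frank_wolfe C f x v \<eta> \<longleftrightarrow>
     x 0 \<in> C \<and>
     (\<forall>t. is_arg_min (\<lambda>u. grad f (x t) \<bullet> u) (\<lambda>u. u \<in> C) (v t) \<and>
          v t extreme_point_of C \<and>
          \<eta> t \<in> {0..1} \<and>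
          x (Suc t) = x t + \<eta> t *\<^sub>R (v t - x t))"

definition line_search ::
    "('a::real_vector \<Rightarrow> real) \<Rightarrow> (nat \<Rightarrow> 'a) \<Rightarrow> (nat \<Rightarrow> 'a) \<Rightarrow> (nat \<Rightarrow> real) \<Rightarrow> bool" where
  "line_search f x v \<eta> \<longleftrightarrow>
     (\<forall>t. is_arg_min (\<lambda>s. f (x t + s *\<^sub>R (v t - x t))) (\<lambda>s. s \<in> {0..1}) (\<eta> t))"

definition short_step ::
    "('a::real_inner \<Rightarrow> real) \<Rightarrow> real \<Rightarrow> (nat \<Rightarrow> 'a) \<Rightarrow> (nat \<Rightarrow> 'a) \<Rightarrow> (nat \<Rightarrow> real) \<Rightarrow> bool" where
  "short_step f L x v \<eta> \<longleftrightarrow>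
     (\<forall>t. is_arg_min (\<lambda>s. f (x t) + s * (grad f (x t) \<bullet> (v t - x t)) + L * s\<^sup>2 / 2)
            (\<lambda>s. s \<in> {0..1}) (\<eta> t))"

lemma GDERIV_grad:
  fixes f :: "'a::euclidean_space \<Rightarrow> real"
  assumes "f differentiable (at x)"
  shows "GDERIV f x :> grad f x"
proof -
  obtain f' where f': "(f has_derivative f') (at x)"
    using assms by (auto simp: differentiable_def)
  interpret bounded_linear f' by (rule has_derivative_bounded_linear[OF f'])
  have "f' = (\<lambda>h. h \<bullet> adjoint f' 1)"
    using adjoint_works[OF linear_axioms] by (auto simp: fun_eq_iff)
  then have D: "GDERIV f x :> adjoint f' 1"
    using f' unfolding gderiv_def by metis
  have "E = adjoint f' 1" if "GDERIV f x :> E" for E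
  proof -
    have "(\<lambda>h. h \<bullet> E) = (\<lambda>h. h \<bullet> adjoint f' 1)"
      using has_derivative_unique that D unfolding gderiv_def by blast
    then have "\<forall>h. h \<bullet> E = h \<bullet> adjoint f' 1" by (simp add: fun_eq_iff)
    then show ?thesis by (simp add: vector_eq_ldot)
  qed
  then show ?thesis
    unfolding grad_def using D by (rule theI[rotated])
qed

lemma opt_value_attained:
  fixes f :: "'a::topological_space \<Rightarrow> real"
  assumes "compact C" "C \<noteq> {}" "continuous_on C f"
  shows "\<exists>x\<in>C. f x = opt_value C f \<and> (\<forall>y\<in>C. f x \<le> f y)"
proof -
  obtain x where x: "x \<in> C" "\<forall>y\<in>C. f x \<le> f y"
    using continuous_attains_inf[OF assms] by blast
  then have "opt_value C f = f x"
    unfolding opt_value_def by (intro cInf_eq_minimum) auto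
  with x show ?thesis by metis
qed

lemma compact_radial:
  fixes C :: "'a::euclidean_space set"
  assumes C: "compact C" and Y: "compact Y"
  shows "compact {\<rho>. \<rho> \<in> {0..1} \<and> (\<exists>y\<in>Y. \<exists>v\<in>C. y - x = \<rho> *\<^sub>R (v - x))}"
proof -
  let ?K = "({0..1::real} \<times> Y \<times> C) \<inter> {p. fst (snd p) - x = fst p *\<^sub>R (snd (snd p) - x)}"
  have "closed {p :: real \<times> 'a \<times> 'a. fst (snd p) - x = fst p *\<^sub>R (snd (snd p) - x)}"
    by (intro closed_Collect_eq continuous_intros)
  then have "compact ?K"
    by (intro compact_Int_closed compact_Times C Y) auto
  then have "compact (fst ` ?K)"
    by (intro compact_continuous_image continuous_intros)
  moreover have "fst ` ?K = {\<rho>. \<rho> \<in> {0..1} \<and> (\<exists>y\<in>Y. \<exists>v\<in>C. y - x = \<rho> *\<^sub>R (v - x))}"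
  proof (intro set_eqI iffI)
    fix \<rho> assume "\<rho> \<in> {\<rho>. \<rho> \<in> {0..1} \<and> (\<exists>y\<in>Y. \<exists>v\<in>C. y - x = \<rho> *\<^sub>R (v - x))}"
    then obtain y v where "\<rho> \<in> {0..1}" "y \<in> Y" "v \<in> C" "y - x = \<rho> *\<^sub>R (v - x)" by blast
    then have "(\<rho>, y, v) \<in> ?K" by simp
    then show "\<rho> \<in> fst ` ?K" by (intro image_eqI[of _ _ "(\<rho>, y, v)"]) simp_all
  next
    fix \<rho> assume "\<rho> \<in> fst ` ?K"
    then obtain p where "p \<in> ?K" "\<rho> = fst p" by blast
    then show "\<rho> \<in> {\<rho>. \<rho> \<in> {0..1} \<and> (\<exists>y\<in>Y. \<exists>v\<in>C. y - x = \<rho> *\<^sub>R (v - x))}"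
      by (cases p) auto
  qed
  ultimately show ?thesis by simp
qed

lemma radial_dist_attained:
  fixes C :: "'a::euclidean_space set"
  assumes C: "compact C" and y: "y \<in> C" and x: "x \<in> C"
  defines "S \<equiv> {\<rho>. \<rho> \<ge> 0 \<and> (\<exists>v\<in>C. y - x = \<rho> *\<^sub>R (v - x))}"
  shows "radial_dist C y x \<in> S" "\<And>\<rho>. \<rho> \<in> S \<Longrightarrow> radial_dist C y x \<le> \<rho>"
    "radial_dist C y x \<in> {0..1}"
proof -
  have bdd: "bdd_below S" unfolding S_def by (rule bdd_belowI[of _ 0]) auto
  have one: "1 \<in> S" using y by (auto simp: S_def)
  then have one01: "1 \<in> S \<inter> {0..1}" by simp
  show low: "radial_dist C y x \<le> \<rho>" if "\<rho> \<in> S" for \<rho>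
    unfolding radial_dist_def S_def[symmetric] using that bdd by (rule cInf_lower)
  have "compact (S \<inter> {0..1})"
    using compact_radial[OF C, of "{y}" x] by (auto simp: S_def Int_def conj_ac)
  then obtain m where m: "m \<in> S \<inter> {0..1}" "\<And>\<rho>. \<rho> \<in> S \<inter> {0..1} \<Longrightarrow> m \<le> \<rho>"
    using compact_attains_inf[of "S \<inter> {0..1}"] one01 by blast
  have "m \<le> \<rho>" if "\<rho> \<in> S" for \<rho>
    using that m by (cases "\<rho> \<le> 1") (auto simp: S_def)
  then have "radial_dist C y x = m"
    unfolding radial_dist_def S_def[symmetric] using m(1) by (intro cInf_eq_minimum) auto
  then show "radial_dist C y x \<in> S" "radial_dist C y x \<in> {0..1}"
    using m(1) by auto
qed

lemma radial_dist_opt_set_attained: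
  fixes C :: "'a::euclidean_space set"
  assumes C: "compact C" "continuous_on C f" and x: "x \<in> C"
  shows "\<exists>y\<in>opt_set C f. radial_dist C y x = (INF y\<in>opt_set C f. radial_dist C y x)"
proof -
  let ?Y = "opt_set C f"
  let ?S = "{\<rho>. \<rho> \<in> {0..1} \<and> (\<exists>y\<in>?Y. \<exists>v\<in>C. y - x = \<rho> *\<^sub>R (v - x))}"
  have YC: "?Y \<subseteq> C" by (auto simp: opt_set_def)
  have ne: "?Y \<noteq> {}"
    using opt_value_attained[OF C(1) _ C(2)] x by (auto simp: opt_set_def)
  have "closed (C \<inter> f -` {opt_value C f})"
    using C by (intro continuous_closed_preimage compact_imp_closed) auto
  moreover have eq: "?Y = C \<inter> (C \<inter> f -` {opt_value C f})"
    by (auto simp: opt_set_def)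
  ultimately have Y: "compact ?Y"
    unfolding eq by (intro compact_Int_closed C(1))
  have memS: "radial_dist C y x \<in> ?S" if "y \<in> ?Y" for y
    using radial_dist_attained(1,3)[OF C(1) _ x, of y] that YC by auto
  then obtain m where m: "m \<in> ?S" "\<And>\<rho>. \<rho> \<in> ?S \<Longrightarrow> m \<le> \<rho>"
    using compact_attains_inf[OF compact_radial[OF C(1) Y, of x]] ne by blast
  obtain y where y: "y \<in> ?Y" "radial_dist C y x \<le> m"
    using m(1) radial_dist_attained(2)[OF C(1) _ x] YC by auto
  have "(INF y\<in>?Y. radial_dist C y x) = radial_dist C y x"
    using y m(2) memS by (intro cInf_eq_minimum) (auto intro: order_trans)
  then show ?thesis using y by metis
qed

end

theory Submission
  imports Defs
begin

text \<open>
  Write \<open>h\<^sub>t = f (x t) - f\<^sup>*\<close> for the primal gap and \<open>g\<^sub>t = \<langle>\<nabla>f (x t), x t - v t\<rangle>\<close> for the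
  Frank-Wolfe gap. The whole argument rests on two comparisons of these quantities.

  \<^item> The radial distance is made for linear minimization. If \<open>y\<close> is a minimizer of \<open>f\<close> at radial
    distance \<open>\<rho>\<close> from \<open>x\<close>, then \<open>y - x = \<rho>(u - x)\<close> with \<open>u\<close> in \<open>C\<close>, and since \<open>v\<close> minimizes the
    linear model over \<open>C\<close>, the decrease that convexity promises towards \<open>y\<close> is at most \<open>\<rho>\<close> times
    the Frank-Wolfe gap: \<open>h \<le> \<rho> g\<close> (\<open>primal_gap_le_radial_dist_times_fw_gap\<close>). The error bound
    replaces \<open>\<rho>\<close> by \<open>(h/\<mu>)\<^sup>\<theta>\<close>, and squaring gives
    \<open>g\<^sup>2 \<ge> \<mu>\<^bsup>2\<theta>\<^esup> h\<^bsup>2-2\<theta>\<^esup>\<close> (\<open>fw_gap_growth\<close>); also \<open>g \<ge> h\<close>, since \<open>\<rho> \<le> 1\<close>.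

  \<^item> Both step rules do at least as well as every fixed step \<open>s \<in> [0,1]\<close> in the quadratic upper model
    \<open>h - s g + L s\<^sup>2/2\<close> (\<open>step_below_model\<close>). The clipped minimizer \<open>s = min(1, g/L)\<close> either
    removes \<open>g\<^sup>2/(2L)\<close>, or it is a full step and removes at least \<open>g/2 \<ge> h/2\<close>.

  Together they give the single recursion
  \<open>h\<^sub>t\<^sub>+\<^sub>1 \<le> h\<^sub>t (1 - min{c h\<^sub>t\<^bsup>a\<^esup>, 1/2})\<close> with \<open>c = \<mu>\<^bsup>2\<theta>\<^esup>/(2L)\<close> and \<open>a = 1 - 2\<theta>\<close>
  (\<open>primal_gap_recursion\<close>); what remains is about real sequences. For \<open>a = 0\<close> the contraction factor
  is constant, so convergence is linear. For \<open>a > 0\<close> the gap is halved while \<open>c h\<^bsup>a\<^esup> > 1/2\<close>, which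
  can only last finitely long; after that \<open>h\<^bsup>-a\<^esup>\<close> increases by at least \<open>a c\<close> in every step.
\<close>

section \<open>Convexity, radial distance and the Frank-Wolfe gap\<close>

text \<open>
  The difference quotients of \<open>f\<close> along the segment from \<open>x\<close> to \<open>y\<close> are at most \<open>f y - f x\<close>, hence so
  is their limit. As \<open>x\<close> may lie on the boundary of \<open>C\<close>, convexity controls the quotients only on the
  side of \<open>y\<close>, which is why the limit is taken from the right.
\<close>

lemma convex_on_above_tangent_plane:
  fixes f :: "'a::euclidean_space \<Rightarrow> real"
  assumes "convex_on C f" "f differentiable (at x)" "x \<in> C" "y \<in> C"
  shows "f x + grad f x \<bullet> (y - x) \<le> f y"
proof -
  let ?p = "\<lambda>s::real. x + s *\<^sub>R (y - x)"
  have p: "(?p has_derivative (\<lambda>s. s *\<^sub>R (y - x))) (at 0)"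
    by (auto intro!: derivative_eq_intros)
  have "(f has_derivative (\<lambda>h. h \<bullet> grad f x)) (at (?p 0))"
    using GDERIV_grad[OF assms(2)] by (simp add: gderiv_def)
  from has_derivative_compose[OF p this]
  have "((\<lambda>s. f (?p s)) has_derivative (\<lambda>s. (s *\<^sub>R (y - x)) \<bullet> grad f x)) (at 0)" .
  then have "((\<lambda>s. f (?p s)) has_field_derivative grad f x \<bullet> (y - x)) (at 0)"
    by (simp add: has_field_derivative_def inner_commute mult_commute_abs)
  then have "((\<lambda>s. (f (?p s) - f x) / s) \<longlongrightarrow> grad f x \<bullet> (y - x)) (at_right 0)"
    by (simp add: has_field_derivative_iff filterlim_at_split)
  moreover have "\<forall>\<^sub>F s in at_right 0. (f (?p s) - f x) / s \<le> f y - f x"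
  proof (rule eventually_at_rightI[of 0 1])
    fix s :: real assume s: "s \<in> {0<..<1}"
    have "?p s = (1 - s) *\<^sub>R x + s *\<^sub>R y" by (simp add: algebra_simps)
    then have "f (?p s) \<le> (1 - s) * f x + s * f y"
      using convex_onD[OF assms(1), of s x y] s assms(3,4) by simp
    then show "(f (?p s) - f x) / s \<le> f y - f x"
      using s by (simp add: field_simps)
  qed simp
  ultimately have "grad f x \<bullet> (y - x) \<le> f y - f x"
    by (rule tendsto_upperbound) simp
  then show ?thesis by simp
qed

lemma primal_gap_le_radial_dist_times_fw_gap:
  fixes f :: "'a::euclidean_space \<Rightarrow> real"
  assumes "compact C" "convex_on C f" "f differentiable (at x)" "x \<in> C" "y \<in> C"
    and v: "is_arg_min (\<lambda>u. grad f x \<bullet> u) (\<lambda>u. u \<in> C) v"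
  shows "f x - f y \<le> radial_dist C y x * (grad f x \<bullet> (x - v))"
proof -
  let ?\<rho> = "radial_dist C y x"
  obtain u where u: "u \<in> C" "y - x = ?\<rho> *\<^sub>R (u - x)" and \<rho>: "?\<rho> \<ge> 0"
    using radial_dist_attained(1)[OF assms(1,5,4)] by auto
  have "grad f x \<bullet> v \<le> grad f x \<bullet> u"
    using v u(1) by (auto simp: is_arg_min_linorder)
  then have "?\<rho> * (grad f x \<bullet> (x - u)) \<le> ?\<rho> * (grad f x \<bullet> (x - v))"
    using \<rho> by (intro mult_left_mono) (auto simp: inner_diff_right)
  moreover have "f x - f y \<le> - (grad f x \<bullet> (y - x))"
    using convex_on_above_tangent_plane[OF assms(2-5)] by simp
  moreover have "- (grad f x \<bullet> (y - x)) = ?\<rho> * (grad f x \<bullet> (x - u))"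
    unfolding u(2) by (simp add: inner_diff_right algebra_simps)
  ultimately show ?thesis by linarith
qed

text \<open>
  Squaring \<open>h \<le> (h/\<mu>)\<^sup>\<theta> g\<close> makes \<open>g\<^sup>2\<close> appear, which is what a step of length \<open>g/L\<close> removes up to the
  factor \<open>2L\<close>. One factor \<open>h\<close> is kept separate on the left because \<open>h \<cdot> (\<mu>\<^bsup>2\<theta>\<^esup> h\<^bsup>1-2\<theta>\<^esup>)\<close> is the form in which that
  step becomes a relative decrease.
\<close>

lemma fw_gap_growth:
  fixes f :: "'a::euclidean_space \<Rightarrow> real" and C :: "'a set"
  defines "h \<equiv> \<lambda>x. f x - opt_value C f"
  assumes "compact C" "convex_on C f" "continuous_on C f" "f differentiable (at x)" "x \<in> C"
    and v: "is_arg_min (\<lambda>u. grad f x \<bullet> u) (\<lambda>u. u \<in> C) v"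
    and "\<mu> > 0" and eb: "error_bound C f (radial_dist C) \<mu> \<theta>" and h: "h x > 0"
  shows "h x \<le> grad f x \<bullet> (x - v)"
    and "h x * (\<mu> powr (2 * \<theta>) * h x powr (1 - 2 * \<theta>)) \<le> (grad f x \<bullet> (x - v))\<^sup>2"
proof -
  let ?g = "grad f x \<bullet> (x - v)" and ?r = "(h x / \<mu>) powr \<theta>"
  obtain y where y: "y \<in> opt_set C f"
    and inf: "radial_dist C y x = (INF y\<in>opt_set C f. radial_dist C y x)"
    using radial_dist_opt_set_attained[OF assms(2,4,6)] by blast
  let ?\<rho> = "radial_dist C y x"
  have yC: "y \<in> C" and fy: "f y = opt_value C f" using y by (auto simp: opt_set_def)
  have le: "h x \<le> ?\<rho> * ?g"
    using primal_gap_le_radial_dist_times_fw_gap[OF assms(2,3,5,6) yC v] fy by (simp add: h_def)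
  have \<rho>: "0 \<le> ?\<rho>" "?\<rho> \<le> 1" using radial_dist_attained(3)[OF assms(2) yC assms(6)] by auto
  have g: "?g > 0"
    using h le \<rho>(1) by (metis less_le_trans mult_nonneg_nonpos not_less)
  show "h x \<le> ?g" using le mult_right_mono[OF \<rho>(2), of ?g] g by linarith
  \<comment> \<open>A positive gap makes \<open>powr\<close> agree with the convention \<open>0\<^sup>0 = 1\<close> of the error bound.\<close>
  have "(if \<theta> = 0 then 1 else ?r) = ?r" using h \<open>\<mu> > 0\<close> by simp
  then have "?\<rho> \<le> ?r"
    using eb \<open>x \<in> C\<close> inf unfolding error_bound_def h_def by metis
  then have "h x \<le> ?r * ?g" using le mult_right_mono[of ?\<rho> ?r ?g] g by linarith
  then have "(h x)\<^sup>2 \<le> (?r * ?g)\<^sup>2" using h by (intro power_mono) auto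
  also have "\<dots> = h x powr (2 * \<theta>) / \<mu> powr (2 * \<theta>) * ?g\<^sup>2"
    using h \<open>\<mu> > 0\<close>
    by (simp add: power_mult_distrib powr_divide power_divide power2_eq_square flip: powr_add)
  finally have "(h x)\<^sup>2 * \<mu> powr (2 * \<theta>) \<le> h x powr (2 * \<theta>) * ?g\<^sup>2"
    using \<open>\<mu> > 0\<close> by (simp add: field_simps)
  then have "(h x)\<^sup>2 * \<mu> powr (2 * \<theta>) / h x powr (2 * \<theta>) \<le> ?g\<^sup>2"
    using h by (simp add: pos_divide_le_eq mult.commute)
  then show "h x * (\<mu> powr (2 * \<theta>) * h x powr (1 - 2 * \<theta>)) \<le> ?g\<^sup>2"
    using h by (simp add: powr_diff power2_eq_square mult_ac)
qed

section \<open>Progress of one step\<close>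

lemma frank_wolfe_in_domain:
  assumes "convex C" "frank_wolfe C f x v \<eta>"
  shows "x t \<in> C"
proof (induction t)
  case 0
  then show ?case using assms(2) by (simp add: frank_wolfe_def)
next
  case (Suc t)
  have "v t \<in> C" "0 \<le> \<eta> t" "\<eta> t \<le> 1" "x (Suc t) = x t + \<eta> t *\<^sub>R (v t - x t)"
    using assms(2) by (auto simp: frank_wolfe_def is_arg_min_def)
  then show ?case
    using convexD_alt[OF assms(1) Suc, of "v t" "\<eta> t"]
    by (simp add: scaleR_left_diff_distrib scaleR_right_diff_distrib add_diff_eq diff_add_eq)
qed

text \<open>
  Line search minimizes \<open>f\<close> itself, which lies below the curvature model for every \<open>s\<close>; the short step
  minimizes the model, which lies above \<open>f\<close> at the minimizer. Either way the new value is below the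
  model at every \<open>s\<close>, so both rules are covered by one analysis.
\<close>

lemma step_below_model:
  assumes "has_curvature C f L" "convex C" "frank_wolfe C f x v \<eta>"
    and rule: "line_search f x v \<eta> \<or> short_step f L x v \<eta>" and s: "s \<in> {0..1}"
  shows "f (x (Suc t)) \<le> f (x t) - s * (grad f (x t) \<bullet> (x t - v t)) + L * s\<^sup>2 / 2"
proof -
  let ?m = "\<lambda>s. f (x t) + s * (grad f (x t) \<bullet> (v t - x t)) + L * s\<^sup>2 / 2"
  let ?p = "\<lambda>s. x t + s *\<^sub>R (v t - x t)"
  have FW: "v t \<in> C" "\<eta> t \<in> {0..1}" "x (Suc t) = ?p (\<eta> t)"
    using assms(3) by (auto simp: frank_wolfe_def is_arg_min_def)
  have model: "f (?p s) \<le> ?m s" if "s \<in> {0..1}" for s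
    using assms(1) frank_wolfe_in_domain[OF assms(2,3), of t] FW(1) that
    unfolding has_curvature_def by blast
  have "f (x (Suc t)) \<le> ?m s"
    using rule
  proof
    assume "line_search f x v \<eta>"
    then have "f (?p (\<eta> t)) \<le> f (?p s)"
      using s by (auto simp: line_search_def is_arg_min_linorder)
    then show ?thesis using FW(3) model[OF s] by simp
  next
    assume "short_step f L x v \<eta>"
    then have "?m (\<eta> t) \<le> ?m s"
      using s by (auto simp: short_step_def is_arg_min_linorder)
    then show ?thesis using FW(3) model[OF FW(2)] by simp
  qed
  then show ?thesis by (simp add: inner_diff_right algebra_simps)
qed

text \<open>
  For \<open>g \<le> L\<close> the model is minimized at \<open>g/L\<close>, and otherwise over \<open>[0,1]\<close> at the full step \<open>1\<close>. The
  two cases yield the two terms of the minimum.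
\<close>

lemma primal_gap_recursion:
  fixes f :: "'a::euclidean_space \<Rightarrow> real" and C :: "'a set"
  defines "h \<equiv> \<lambda>x. f x - opt_value C f"
  assumes "compact C" "convex_on C f" "continuous_on C f" "\<And>x. x \<in> C \<Longrightarrow> f differentiable (at x)"
    and "L > 0" "has_curvature C f L" "\<mu> > 0" "error_bound C f (radial_dist C) \<mu> \<theta>"
    and FW: "frank_wolfe C f x v \<eta>" and rule: "line_search f x v \<eta> \<or> short_step f L x v \<eta>"
  shows "h (x t) \<ge> 0"
    and "h (x (Suc t))
      \<le> h (x t) * (1 - min (\<mu> powr (2 * \<theta>) / (2 * L) * h (x t) powr (1 - 2 * \<theta>)) (1/2))"
proof -
  let ?g = "grad f (x t) \<bullet> (x t - v t)"
  let ?k = "\<mu> powr (2 * \<theta>) * h (x t) powr (1 - 2 * \<theta>)"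
  have cv: "convex C" using assms(3) by (rule convex_on_imp_convex)
  have xC: "x t \<in> C" using cv FW by (rule frank_wolfe_in_domain)
  show h0: "h (x t) \<ge> 0"
    using opt_value_attained[OF assms(2) _ assms(4)] xC by (force simp: h_def)
  have step: "h (x (Suc t)) \<le> h (x t) - s * ?g + L * s\<^sup>2 / 2" if "s \<in> {0..1}" for s
    using step_below_model[OF assms(7) cv FW rule that, of t] by (simp add: h_def)
  have "h (x (Suc t)) \<le> h (x t) * (1 - min (?k / (2 * L)) (1/2))"
  proof (cases "h (x t) = 0")
    case True
    then show ?thesis using step[of 0] by simp
  next
    case False
    then have hp: "f (x t) - opt_value C f > 0" using h0 by (simp add: h_def)
    have v: "is_arg_min (\<lambda>u. grad f (x t) \<bullet> u) (\<lambda>u. u \<in> C) (v t)"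
      using FW by (simp add: frank_wolfe_def)
    have growth: "h (x t) \<le> ?g" "h (x t) * ?k \<le> ?g\<^sup>2"
      using fw_gap_growth[OF assms(2-4) assms(5)[OF xC] xC v assms(8,9) hp]
      by (simp_all only: h_def)
    show ?thesis
    proof (cases "?g \<le> L")
      case True
      have "?g > 0" using growth(1) hp by (simp add: h_def)
      then have "h (x (Suc t)) \<le> h (x t) - ?g\<^sup>2 / (2 * L)"
        using step[of "?g / L"] True \<open>L > 0\<close> by (simp add: field_simps power2_eq_square)
      moreover have "?g\<^sup>2 / (2 * L) \<ge> h (x t) * (?k / (2 * L))"
        using growth(2) \<open>L > 0\<close> by (simp add: field_simps)
      moreover have "h (x t) * (?k / (2 * L)) \<ge> h (x t) * min (?k / (2 * L)) (1/2)"
        using h0 by (intro mult_left_mono) auto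
      ultimately show ?thesis unfolding right_diff_distrib by linarith
    next
      case False
      then have "h (x (Suc t)) \<le> h (x t) - h (x t) * (1/2)"
        using step[of 1] growth(1) by simp
      moreover have "h (x t) * (1/2) \<ge> h (x t) * min (?k / (2 * L)) (1/2)"
        using h0 by (intro mult_left_mono) auto
      ultimately show ?thesis unfolding right_diff_distrib by linarith
    qed
  qed
  then show "h (x (Suc t))
      \<le> h (x t) * (1 - min (\<mu> powr (2 * \<theta>) / (2 * L) * h (x t) powr (1 - 2 * \<theta>)) (1/2))"
    by simp
qed

section \<open>Rates from the recursion\<close>

lemma geometric_decay:
  fixes h :: "nat \<Rightarrow> real"
  assumes "q \<ge> 0" "\<And>t. t < n \<Longrightarrow> h (Suc t) \<le> h t * q" "t \<le> n"
  shows "h t \<le> h 0 * q ^ t"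
  using assms(3)
proof (induction t)
  case (Suc t)
  then have "h (Suc t) \<le> h t * q" using assms(2) by simp
  also have "\<dots> \<le> h 0 * q ^ t * q" using Suc assms(1) by (intro mult_right_mono) auto
  finally show ?case by (simp add: mult_ac)
qed simp

text \<open>
  Since \<open>(1 - u)\<^bsup>-a\<^esup> \<ge> e\<^bsup>a u\<^esup> \<ge> 1 + a u\<close>, taking the power \<open>-a\<close> of \<open>h' \<le> h (1 - c h\<^bsup>a\<^esup>)\<close> turns the
  nonlinear recursion into an additive one.
\<close>

lemma inverse_power_increase:
  fixes h h' a c :: real
  assumes "h > 0" "h' > 0" "a \<ge> 0" "h' \<le> h * (1 - c * h powr a)"
  shows "h powr (-a) + a * c \<le> h' powr (-a)"
proof -
  let ?u = "c * h powr a"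
  have "0 < h * (1 - ?u)" using assms(2,4) by linarith
  then have u: "1 - ?u > 0" using assms(1) by (simp add: zero_less_mult_iff)
  have "1 + a * ?u \<le> exp (a * ?u)" by (rule exp_ge_add_one_self)
  also have "\<dots> \<le> exp (- a * ln (1 - ?u))"
    using ln_le_minus_one[OF u] mult_left_mono[of "ln (1 - ?u)" "- ?u" a] \<open>a \<ge> 0\<close> by simp
  also have "\<dots> = (1 - ?u) powr (-a)" using u by (simp add: powr_def)
  finally have "h powr (-a) * (1 + a * ?u) \<le> h powr (-a) * (1 - ?u) powr (-a)"
    by (intro mult_left_mono) auto
  also have "\<dots> = (h * (1 - ?u)) powr (-a)" using assms(1) u by (simp add: powr_mult)
  also have "\<dots> \<le> h' powr (-a)" using assms by (intro powr_mono2') auto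
  finally have "h powr (-a) * (1 + a * ?u) \<le> h' powr (-a)" .
  moreover have "h powr (-a) * (1 + a * ?u) = h powr (-a) + a * c * (h powr (-a) * h powr a)"
    by (simp add: algebra_simps)
  moreover have "h powr (-a) * h powr a = 1" using assms(1) by (simp flip: powr_add)
  ultimately show ?thesis by simp
qed

text \<open>
  A sequence that reaches \<open>0\<close> stays there, so the inverse powers only have to be compared as long as
  the current term is positive, and then all earlier terms are positive as well.
\<close>

lemma sublinear_decay:
  fixes h :: "nat \<Rightarrow> real"
  assumes a: "a > 0" and c: "c \<ge> 0" and h0: "\<And>t. h t \<ge> 0"
    and rec: "\<And>t. h (Suc t) \<le> h t * (1 - c * h t powr a)" and pos: "h 0 > 0"
  shows "h t \<le> (h 0 powr (-a) + a * c * real t) powr (- (1 / a))"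
proof (cases "h t = 0")
  case False
  have inv: "h 0 powr (-a) + a * c * real t \<le> h t powr (-a)" if "h t > 0" for t
    using that
  proof (induction t)
    case (Suc t)
    have "h t \<noteq> 0" using rec[of t] Suc.prems by auto
    then have ht: "h t > 0" using h0[of t] by simp
    have "h t powr (-a) + a * c \<le> h (Suc t) powr (-a)"
      using inverse_power_increase[OF ht Suc.prems _ rec] a by simp
    then show ?case using Suc.IH[OF ht] by (simp add: algebra_simps)
  qed simp
  have ht: "h t > 0" using False h0[of t] by simp
  have "h 0 powr (-a) + a * c * real t > 0" using a c pos by (intro add_pos_nonneg) auto
  then have "(h t powr (-a)) powr (- (1 / a))
      \<le> (h 0 powr (-a) + a * c * real t) powr (- (1 / a))"
    using inv[OF ht] a by (intro powr_mono2') auto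
  then show ?thesis using a ht by (simp add: powr_powr)
qed simp

text \<open>
  If the burn-in phase did not end, \<open>h\<close> would be halved forever and tend to \<open>0\<close>, and so would
  \<open>c h\<^bsup>a\<^esup>\<close>, which exceeds \<open>1/2\<close> throughout that phase. Once \<open>c h\<^bsup>a\<^esup> \<le> 1/2\<close> holds it persists,
  because \<open>h\<close> does not increase.
\<close>

lemma two_phase_decay:
  fixes h :: "nat \<Rightarrow> real"
  assumes a: "a > 0" and c: "c > 0" and h0: "\<And>t. h t \<ge> 0"
    and rec: "\<And>t. h (Suc t) \<le> h t * (1 - min (c * h t powr a) (1/2))"
  shows "\<exists>t0. c * h t0 powr a \<le> 1/2 \<and> (\<forall>t<t0. \<not> c * h t powr a \<le> 1/2) \<and>
    (\<forall>t\<le>t0. h t \<le> h 0 / 2 ^ t) \<and>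
    (\<forall>t>t0. h t \<le> (if h t0 = 0 then 0
        else (h t0 powr (-a) + a * c * real (t - t0)) powr (- (1 / a))))"
proof -
  let ?P = "\<lambda>t. c * h t powr a \<le> 1/2"
  have halving: "h t \<le> h 0 * (1/2) ^ t" if "\<And>s. s < n \<Longrightarrow> \<not> ?P s" "t \<le> n" for n t
  proof (rule geometric_decay[OF _ _ that(2)])
    fix s assume "s < n"
    then have "min (c * h s powr a) (1/2) = 1/2" using that(1)[of s] by simp
    then show "h (Suc s) \<le> h s * (1/2)" using rec[of s] by simp
  qed simp
  have "\<exists>t. ?P t"
  proof (rule ccontr)
    assume neg: "\<nexists>t. ?P t"
    have "(\<lambda>t. h 0 * (1/2) ^ t) \<longlonglongrightarrow> h 0 * 0"
      by (intro tendsto_mult tendsto_const LIMSEQ_realpow_zero) auto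
    moreover have "h t \<le> h 0 * (1/2) ^ t" for t using halving[of t t] neg by blast
    ultimately have "h \<longlonglongrightarrow> 0"
      using h0 by (intro real_tendsto_sandwich[of "\<lambda>_. 0" h _ "\<lambda>t. h 0 * (1/2) ^ t"]) auto
    then have "(\<lambda>t. h t powr a) \<longlonglongrightarrow> 0"
      using tendsto_zero_powrI[OF _ tendsto_const _ a, of h] h0 by simp
    then have "(\<lambda>t. c * h t powr a) \<longlonglongrightarrow> 0" by (rule tendsto_mult_right_zero)
    then have "\<forall>\<^sub>F t in sequentially. c * h t powr a < 1/2" by (rule order_tendstoD) simp
    then obtain t where "c * h t powr a < 1/2" by (auto dest: eventually_happens)
    then show False using neg less_imp_le by blast
  qed
  then obtain t0 where P: "?P t0" and least: "\<And>t. t < t0 \<Longrightarrow> \<not> ?P t"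
    using exists_least_iff[of ?P] by blast
  have mono: "h (Suc t) \<le> h t" for t
    using rec[of t] mult_left_mono[of "1 - min (c * h t powr a) (1/2)" 1 "h t"] h0[of t] c by simp
  have late: "?P (t0 + t)" for t
  proof -
    have "h (t0 + t) \<le> h t0" by (induction t) (auto intro: order_trans[OF mono])
    then have "c * h (t0 + t) powr a \<le> c * h t0 powr a"
      using a c h0 by (intro mult_left_mono powr_mono2) auto
    then show ?thesis using P by linarith
  qed
  have rec_late: "h (t0 + Suc t) \<le> h (t0 + t) * (1 - c * h (t0 + t) powr a)" for t
    using rec[of "t0 + t"] late[of t] by simp
  have "h t \<le> h 0 / 2 ^ t" if "t \<le> t0" for t
    using halving[OF least that] by (simp add: power_divide)
  moreover have "h t \<le> (if h t0 = 0 then 0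
        else (h t0 powr (-a) + a * c * real (t - t0)) powr (- (1 / a)))" if "t > t0" for t
  proof (cases "h t0 = 0")
    case True
    have "h (t0 + s) \<le> 0" for s by (induction s) (auto simp: True intro: order_trans[OF mono])
    from this[of "t - t0"] show ?thesis using that True by simp
  next
    case False
    then have "h (t0 + 0) > 0" using h0[of t0] by simp
    from sublinear_decay[of a c "\<lambda>s. h (t0 + s)" "t - t0", OF a _ h0 rec_late this]
    show ?thesis using that c False by simp
  qed
  ultimately show ?thesis using P least by blast
qed

section \<open>Convergence of the Frank-Wolfe algorithm\<close>

theorem theorem3p2:
  fixes C U :: "(real ^ 'n) set" and f :: "real ^ 'n \<Rightarrow> real"
    and x v :: "nat \<Rightarrow> real ^ 'n" and \<eta> :: "nat \<Rightarrow> real" and L \<mu> \<theta> :: real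
  assumes "polytope C" and "C \<noteq> {}"
    and "convex_on C f"
    and "open U" and "C \<subseteq> U" and "f differentiable_on U"
    and "L > 0" and "has_curvature C f L"
    and "\<mu> > 0" and "\<theta> \<in> {0..1/2}" and "error_bound C f (radial_dist C) \<mu> \<theta>"
    and "frank_wolfe C f x v \<eta>"
    and "line_search f x v \<eta> \<or> short_step f L x v \<eta>"
  shows
    "(\<theta> = 1/2 \<longrightarrow>
       (\<forall>t. f (x t) - opt_value C f
             \<le> (f (x 0) - opt_value C f) * (1 - min (\<mu> / (2 * L)) (1/2)) ^ t))
     \<and>
     (\<theta> < 1/2 \<longrightarrow>
       (\<exists>t0.
          \<mu> powr (2 * \<theta>) * (f (x t0) - opt_value C f) powr (1 - 2 * \<theta>) / (2 * L) \<le> 1/2 \<and>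
          (\<forall>t<t0. \<not> \<mu> powr (2 * \<theta>) * (f (x t) - opt_value C f) powr (1 - 2 * \<theta>) / (2 * L) \<le> 1/2) \<and>
          (\<forall>t\<le>t0. f (x t) - opt_value C f \<le> (f (x 0) - opt_value C f) / 2 ^ t) \<and>
          (\<forall>t>t0. f (x t) - opt_value C f
             \<le> (if f (x t0) - opt_value C f = 0 then 0
                else ((f (x t0) - opt_value C f) powr (2 * \<theta> - 1)
                      + (1 - 2 * \<theta>) * \<mu> powr (2 * \<theta>) * real (t - t0) / (2 * L))
                     powr (1 / (2 * \<theta> - 1))))))"
proof -
  let ?h = "\<lambda>t. f (x t) - opt_value C f"
  let ?c = "\<mu> powr (2 * \<theta>) / (2 * L)" and ?a = "1 - 2 * \<theta>"
  have C: "compact C" using assms(1) by (rule polytope_imp_compact)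
  have cont: "continuous_on C f"
    using differentiable_imp_continuous_on[OF assms(6)] assms(5) by (rule continuous_on_subset)
  have diff: "f differentiable (at y)" if "y \<in> C" for y
    using assms(4-6) that by (meson subsetD differentiable_on_eq_differentiable_at)
  note recursion = primal_gap_recursion[OF C assms(3) cont diff assms(7,8,9,11,12,13)]
  have c: "?c > 0" using assms(7,9) by simp
  show ?thesis
  proof (intro conjI impI allI)
    fix t assume \<theta>: "\<theta> = 1/2"
    let ?q = "1 - min (\<mu> / (2 * L)) (1/2)"
    show "?h t \<le> ?h 0 * ?q ^ t"
    proof (rule geometric_decay[of _ t])
      fix s
      show "?h (Suc s) \<le> ?h s * ?q"
        \<comment> \<open>At a vanishing gap the exponent \<open>0\<close> gives \<open>0 powr 0 = 0\<close> instead of \<open>1\<close>, but there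
            the right-hand side is \<open>0\<close> in either case.\<close>
        using recursion(2)[of s] recursion(1)[of s] assms(9)
        by (cases "?h s = 0") (simp_all add: \<theta>)
    qed auto
  next
    assume "\<theta> < 1/2"
    then have a: "?a > 0" by simp
    have eq: "\<mu> powr (2 * \<theta>) * z powr ?a / (2 * L) = ?c * z powr ?a" for z by simp
    have ea: "2 * \<theta> - 1 = - ?a" and ei: "1 / (2 * \<theta> - 1) = - (1 / ?a)"
      using a by (simp_all add: field_simps)
    have er: "?a * \<mu> powr (2 * \<theta>) * k / (2 * L) = ?a * ?c * k" for k by simp
    show "\<exists>t0.
          \<mu> powr (2 * \<theta>) * ?h t0 powr ?a / (2 * L) \<le> 1/2 \<and>
          (\<forall>t<t0. \<not> \<mu> powr (2 * \<theta>) * ?h t powr ?a / (2 * L) \<le> 1/2) \<and>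
          (\<forall>t\<le>t0. ?h t \<le> ?h 0 / 2 ^ t) \<and>
          (\<forall>t>t0. ?h t \<le> (if ?h t0 = 0 then 0
                else (?h t0 powr (2 * \<theta> - 1) + ?a * \<mu> powr (2 * \<theta>) * real (t - t0) / (2 * L))
                     powr (1 / (2 * \<theta> - 1))))"
      unfolding eq er ei unfolding ea
      by (rule two_phase_decay[of ?a ?c ?h, OF a c recursion])
  qed
qed

end
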